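(* Let $K$ be an infinite field and $n\le r$ integers with $r\le 4n/3$. One can choose $R\in GL_r(K)$ and three diagonal matrices $D_1,D_2,D_3\in M_r(K)$ such that, with $Z_i=R^{-1}D_iR$ and $A_i$ the top-left $n\times n$ block of $Z_i$ ($i=1,2,3$), one has $\dim(\operatorname{Im}[A_1,A_2]+\operatorname{Im}[A_1,A_3])=3(r-n)$.
   Context: $[A,B]=AB-BA$, $\operatorname{Im}A$ denotes the column space. *)

theory Defs
  imports Complex_Main "Jordan_Normal_Form.DL_Rank"
begin

definition commutator :: "'a::ring mat \<Rightarrow> 'a mat \<Rightarrow> 'a mat" where
  "commutator A B = A * B - B * A"

definition top_left_block :: "nat \<Rightarrow> 'a mat \<Rightarrow> 'a mat" where
  "top_left_block n Z = mat n n (\<lambda>(i, j). Z $$ (i, j))"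

abbreviation Im_mat :: "nat \<Rightarrow> 'a::field mat \<Rightarrow> 'a vec set" where
  "Im_mat n A \<equiv> vec_space.col_space n A"

abbreviation vec_subspace_sum :: "nat \<Rightarrow> 'a::field vec set \<Rightarrow> 'a vec set \<Rightarrow> 'a vec set" where
  "vec_subspace_sum n U W \<equiv> LinearCombinations.module.submodule_sum (module_vec TYPE('a) n) U W"

abbreviation vec_subspace_dim :: "nat \<Rightarrow> 'a::field vec set \<Rightarrow> nat" where
  "vec_subspace_dim n W \<equiv> vectorspace.dim class_ring ((module_vec TYPE('a) n)\<lparr>carrier := W\<rparr>)"

end

theory Submission
  imports Defs
begin

text \<open>
  Put $m = r - n$, so $3m \le n$. Let $U_0, U_1, U_2 : K^m \to K^n$ be the inclusions of the first
  three blocks of $m$ coordinates and $T_a$ the transpose of $U_a$, so that $T_a U_b = \delta_{ab}$.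
  With $W = U_0 + U_1 + U_2$ and $X = T_1 - T_0$ one has $XW = 0$, hence
  $R = (1, W; X, 1)$ has the inverse $(G, -W; -X, 1)$, where $G = 1 + WX$ is itself invertible
  with inverse $1 - WX$. Let $D_a$ be the coordinate projection onto the $a$-th block, so that
  $A_a = G U_a T_a$ and $A_a A_b = G U_a (X U_b) T_b$ for $a \ne b$. Since $X U_0 = -1$, $X U_1 = 1$
  and $X U_2 = 0$, this gives $[A_0, A_1] = G (U_0 T_1 + U_1 T_0)$ and $[A_0, A_2] = G U_2 T_0$,
  whose images together span $G$ applied to the first $3m$ coordinates.
\<close>

text \<open>The left inverse makes multiplication by \<open>H\<close> injective. On unit vectors
  this separates the columns, and on a kernel vector it gives independence. Distinctness is shown
  separately because \<open>lin_indpt\<close> speaks of the set of columns and cannot see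
  repetitions.\<close>

lemma (in vec_space) rank_left_invertible:
  assumes H: "H \<in> carrier_mat n k" and L: "L \<in> carrier_mat k n" and LH: "L * H = 1\<^sub>m k"
  shows "rank H = k"
proof -
  have inj: "v = w" if v: "v \<in> carrier_vec k" and w: "w \<in> carrier_vec k"
    and eq: "H *\<^sub>v v = H *\<^sub>v w" for v w
  proof -
    have "v = L *\<^sub>v (H *\<^sub>v v)" using assoc_mult_mat_vec[OF L H v] LH v by simp
    also have "\<dots> = w" using assoc_mult_mat_vec[OF L H w] LH w eq by simp
    finally show ?thesis .
  qed
  have colH: "col H i = H *\<^sub>v unit_vec k i" if "i < k" for i
    using H that by (intro eq_vecI) auto
  have dist: "distinct (cols H)"
    unfolding distinct_conv_nth
  proof (intro allI impI)
    fix i j assume ij: "i < length (cols H)" "j < length (cols H)" "i \<noteq> j"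
    have "H *\<^sub>v unit_vec k i \<noteq> H *\<^sub>v unit_vec k j"
      using inj[of "unit_vec k i" "unit_vec k j"] ij H by auto
    then show "cols H ! i \<noteq> cols H ! j" using ij H colH by auto
  qed
  moreover have "lin_indpt (set (cols H))"
  proof
    assume "lin_dep (set (cols H))"
    then obtain v where v: "v \<in> carrier_vec k" "v \<noteq> 0\<^sub>v k" "H *\<^sub>v v = 0\<^sub>v n"
      using lin_depE[OF H _ dist] by blast
    have "H *\<^sub>v 0\<^sub>v k = 0\<^sub>v n" using H by (intro eq_vecI) auto
    then show False using inj[of v "0\<^sub>v k"] v by auto
  qed
  ultimately show ?thesis using lin_indpt_full_rank[OF H] by blast
qed

text \<open>Both images lie in that of \<open>H\<close> since \<open>A\<close> and \<open>B\<close>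
  factor through \<open>H\<close> on the left; \<open>H_eq\<close> gives the reverse inclusion. So
  the sum is the column space of \<open>H\<close>, and the left inverse \<open>L\<close> fixes its
  dimension.\<close>

lemma dim_sum_of_images:
  fixes A B :: "'a::field mat"
  assumes A': "A' \<in> carrier_mat k n" and B': "B' \<in> carrier_mat k n"
    and H: "H \<in> carrier_mat n k" and L: "L \<in> carrier_mat k n"
    and Q: "Q \<in> carrier_mat n k" and Q': "Q' \<in> carrier_mat n k"
    and A_eq: "A = H * A'" and B_eq: "B = H * B'"
    and H_eq: "H = A * Q + B * Q'" and LH: "L * H = 1\<^sub>m k"
  shows "vec_subspace_dim n (vec_subspace_sum n (Im_mat n A) (Im_mat n B)) = k"
proof -
  interpret V: vec_space "TYPE('a)" n .
  have A: "A \<in> carrier_mat n n" and B: "B \<in> carrier_mat n n"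
    unfolding A_eq B_eq using A' B' H by auto
  have img: "V.col_space M = {M *\<^sub>v x | x. x \<in> carrier_vec c}" if "M \<in> carrier_mat n c" for M c
    using that by (auto simp: V.col_space_eq[OF that])
  have "V.submodule_sum (V.col_space A) (V.col_space B) = V.col_space H"
    (is "?S = _")
  proof
    show "?S \<subseteq> V.col_space H"
    proof
      fix z assume "z \<in> ?S"
      then obtain x y where xy: "x \<in> carrier_vec n" "y \<in> carrier_vec n"
        and z: "z = A *\<^sub>v x + B *\<^sub>v y"
        unfolding V.submodule_sum_def img[OF A] img[OF B] by auto
      have "z = H *\<^sub>v (A' *\<^sub>v x + B' *\<^sub>v y)"
        unfolding z A_eq B_eq using xy A' B' H
        by (simp add: mult_add_distrib_mat_vec[OF H])
      then show "z \<in> V.col_space H"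
        unfolding img[OF H] using xy A' B' by (auto intro!: exI[of _ "A' *\<^sub>v x + B' *\<^sub>v y"])
    qed
    show "V.col_space H \<subseteq> ?S"
    proof
      fix z assume "z \<in> V.col_space H"
      then obtain x where x: "x \<in> carrier_vec k" and z: "z = H *\<^sub>v x"
        unfolding img[OF H] by auto
      have "z = (A * Q + B * Q') *\<^sub>v x"
        using z H_eq by simp
      also have "\<dots> = (A * Q) *\<^sub>v x + (B * Q') *\<^sub>v x"
        using A B Q Q' x by (intro add_mult_distrib_mat_vec) auto
      also have "\<dots> = A *\<^sub>v (Q *\<^sub>v x) + B *\<^sub>v (Q' *\<^sub>v x)"
        using A B Q Q' x by simp
      finally have "z = A *\<^sub>v (Q *\<^sub>v x) + B *\<^sub>v (Q' *\<^sub>v x)" .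
      moreover have "Q *\<^sub>v x \<in> carrier_vec n" "Q' *\<^sub>v x \<in> carrier_vec n" using Q Q' x by auto
      ultimately show "z \<in> ?S"
        unfolding V.submodule_sum_def img[OF A] img[OF B]
        by (auto intro!: image_eqI[of _ _ "(A *\<^sub>v (Q *\<^sub>v x), B *\<^sub>v (Q' *\<^sub>v x))"])
    qed
  qed
  then show ?thesis
    using V.rank_left_invertible[OF H L LH] unfolding V.rank_def V.col_space_def by simp
qed

section \<open>Inclusions of coordinate blocks\<close>

definition block_inclusion :: "nat \<Rightarrow> nat \<Rightarrow> nat \<Rightarrow> 'a::field mat" where
  "block_inclusion N m a = mat N m (\<lambda>(i, k). if i = a * m + k then 1 else 0)"

lemma block_inclusion_carrier [simp]:
  "block_inclusion N m a \<in> carrier_mat N m"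
  "transpose_mat (block_inclusion N m a) \<in> carrier_mat m N"
  by (auto simp: block_inclusion_def)

lemmas block_inclusion_dim [simp] = carrier_matD[OF block_inclusion_carrier(1)]

lemma transpose_block_inclusion_mult:
  assumes "(a + 1) * m \<le> N"
  shows "transpose_mat (block_inclusion N m a) * block_inclusion N m b
    = (if a = b then 1\<^sub>m m else 0\<^sub>m m m :: 'a::field mat)"
proof (rule eq_matI)
  fix k l assume "k < dim_row (if a = b then 1\<^sub>m m else 0\<^sub>m m m :: 'a mat)"
    and "l < dim_col (if a = b then 1\<^sub>m m else 0\<^sub>m m m :: 'a mat)"
  then have kl: "k < m" "l < m" by (auto split: if_splits)
  have "a * m + k < N" using assms kl by (simp add: algebra_simps)
  moreover have "a * m + k = b * m + l \<longleftrightarrow> a = b \<and> k = l"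
  proof
    assume eq: "a * m + k = b * m + l"
    \<comment> \<open>Offsets below \<open>m\<close> allow the block index to be recovered by
      division.\<close>
    have "a = (a * m + k) div m" "b = (b * m + l) div m" using kl by auto
    then show "a = b \<and> k = l" using eq by auto
  qed simp
  moreover have "(transpose_mat (block_inclusion N m a) * block_inclusion N m b) $$ (k, l) =
      (\<Sum>i = 0..<N. (if i = a * m + k then 1 else 0) * (if i = b * m + l then 1 else 0 :: 'a))"
    using kl by (simp add: block_inclusion_def scalar_prod_def)
  moreover have "\<dots> = (\<Sum>i = 0..<N. if i = a * m + k then if i = b * m + l then 1 else 0 else 0)"
    by (rule sum.cong) auto
  ultimately show "(transpose_mat (block_inclusion N m a) * block_inclusion N m b) $$ (k, l)
      = (if a = b then 1\<^sub>m m else 0\<^sub>m m m :: 'a mat) $$ (k, l)"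
    using kl by (simp add: sum.delta)
qed (auto simp: block_inclusion_def)

text \<open>With \<open>N = N'\<close> this is the coordinate projection onto a block, whose
  diagonal shape is needed for \<open>D\<close>; the rectangular case gives the summands of
  \<open>J\<close>.\<close>

lemma block_inclusion_mult_transpose:
  assumes "i < N" "j < N'"
  shows "(block_inclusion N m a * transpose_mat (block_inclusion N' m a)) $$ (i, j)
    = (if i = j \<and> a * m \<le> i \<and> i < (a + 1) * m then 1 else 0 :: 'a::field)"
proof -
  have "(block_inclusion N m a * transpose_mat (block_inclusion N' m a)) $$ (i, j) =
      (\<Sum>k = 0..<m. (if i = a * m + k then 1 else 0) * (if j = a * m + k then 1 else 0 :: 'a))"
    using assms by (simp add: block_inclusion_def scalar_prod_def)
  \<comment> \<open>The condition \<open>i = a * m + k\<close> is solved for \<open>k\<close>;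
    subtraction on naturals truncates, hence the guard \<open>a * m \<le> i\<close>.\<close>
  also have "\<dots> = (\<Sum>k = 0..<m. if k = i - a * m then if a * m \<le> i \<and> i = j then 1 else 0 else 0)"
    by (rule sum.cong) auto
  also have "\<dots> = (if i = j \<and> a * m \<le> i \<and> i < (a + 1) * m then 1 else 0 :: 'a)"
    by (auto simp: sum.delta algebra_simps)
  finally show ?thesis .
qed

text \<open>Prepares the matrix \<open>H = G * J\<close> of the main proof: the first fact expands
  \<open>H\<close> over the blocks, the second leads to a left inverse of \<open>H\<close>, and the
  third makes each \<open>G * U a\<close> factor through \<open>H\<close>.\<close>

lemma sum_of_block_inclusions:
  fixes N m :: nat
  assumes "3 * m \<le> N"
  defines "J \<equiv> mat N (3 * m) (\<lambda>(i, j). if i = j then 1 else 0 :: 'a::field)"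
  shows "J = block_inclusion N m 0 * transpose_mat (block_inclusion (3 * m) m 0)
      + block_inclusion N m 1 * transpose_mat (block_inclusion (3 * m) m 1)
      + block_inclusion N m 2 * transpose_mat (block_inclusion (3 * m) m 2)" (is ?res)
    and "transpose_mat J * J = 1\<^sub>m (3 * m)" (is ?iso)
    and "a < 3 \<Longrightarrow> J * block_inclusion (3 * m) m a = block_inclusion N m a"
proof -
  show ?res
    unfolding J_def
    by (rule eq_matI)
      (auto simp: block_inclusion_mult_transpose simp del: index_mult_mat(1))
  show ?iso
    unfolding J_def using assms(1)
    by (intro eq_matI) (auto simp: scalar_prod_def if_distrib sum.delta cong: if_cong)
  assume "a < 3"
  then have "(a + 1) * m \<le> 3 * m" by (intro mult_le_mono1) simp
  then have "a * m + k < 3 * m" if "k < m" for k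
    using that unfolding add_mult_distrib by linarith
  then show "J * block_inclusion (3 * m) m a = block_inclusion N m a"
    unfolding J_def block_inclusion_def using assms(1)
    by (intro eq_matI) (auto simp: scalar_prod_def if_distrib sum.delta cong: if_cong)
qed

lemma top_left_block_four_block_mat:
  assumes "A \<in> carrier_mat n n"
  shows "top_left_block n (four_block_mat A B C D) = A"
  using assms by (intro eq_matI) (auto simp: top_left_block_def)

theorem theorem8:
  fixes n r :: nat
  assumes "infinite (UNIV :: 'a::field set)"
    and "n \<le> r"
    and "real r \<le> 4 * real n / 3"
  shows "\<exists>R R' D1 D2 D3 :: 'a mat.
    R \<in> carrier_mat r r \<and> R' \<in> carrier_mat r r \<and> inverts_mat R R' \<and> inverts_mat R' R \<and>
    D1 \<in> carrier_mat r r \<and> D2 \<in> carrier_mat r r \<and> D3 \<in> carrier_mat r r \<and>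
    diagonal_mat D1 \<and> diagonal_mat D2 \<and> diagonal_mat D3 \<and>
    (let Z1 = R' * D1 * R; Z2 = R' * D2 * R; Z3 = R' * D3 * R;
         A1 = top_left_block n Z1; A2 = top_left_block n Z2; A3 = top_left_block n Z3
     in vec_subspace_dim n
          (vec_subspace_sum n (Im_mat n (commutator A1 A2)) (Im_mat n (commutator A1 A3)))
        = 3 * (r - n))"
proof -
  \<comment> \<open>Keeps the block index \<open>1\<close> from becoming \<open>Suc 0\<close>, and
    reduces carrier conditions to dimensions.\<close>
  note [simp del] = One_nat_def and [simp] = carrier_matI
  define m where "m = r - n"
  have r: "r = n + m" using assms(2) by (simp add: m_def)
  \<comment> \<open>Cleared of denominators, the bound on \<open>r\<close> says exactly that three
    disjoint blocks of size \<open>m\<close> fit into \<open>n\<close> coordinates.\<close>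
  have "3 * r \<le> 4 * n"
    using assms(3) by (simp add: field_simps)
  then have m3: "3 * m \<le> n" using r by simp

  \<comment> \<open>The matrices W, X and G\<close>
  define U :: "nat \<Rightarrow> 'a mat" where "U = block_inclusion n m"
  define T where "T a = transpose_mat (U a)" for a
  have U [simp]: "U a \<in> carrier_mat n m" and T [simp]: "T a \<in> carrier_mat m n" for a
    by (simp_all add: U_def T_def)
  note [simp] = carrier_matD[OF U] carrier_matD[OF T]
  have TU: "T a * U b = (if a = b then 1\<^sub>m m else 0\<^sub>m m m)" if "a < 3" for a b
  proof -
    have "(a + 1) * m \<le> 3 * m" using that by (intro mult_le_mono1) simp
    then have "(a + 1) * m \<le> n" using m3 by linarith
    then show ?thesis unfolding T_def U_def by (rule transpose_block_inclusion_mult)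
  qed
  define W where "W = U 0 + U 1 + U 2"
  define X where "X = T 1 - T 0"
  define G where "G = 1\<^sub>m n + W * X"
  have W [simp]: "W \<in> carrier_mat n m" and X [simp]: "X \<in> carrier_mat m n"
    by (simp_all add: W_def X_def)
  note [simp] = carrier_matD[OF W] carrier_matD[OF X]
  have G [simp]: "G \<in> carrier_mat n n" by (simp add: G_def)
  note [simp] = carrier_matD[OF G]
  have TW: "T a * W = 1\<^sub>m m" if "a < 3" for a
  proof -
    have "T a * W = T a * U 0 + T a * U 1 + T a * U 2"
      unfolding W_def by (simp add: mult_add_distrib_mat[of _ m n _ m])
    also have "\<dots> = 1\<^sub>m m"
      using that by (cases "a = 0"; cases "a = 1"; cases "a = 2") (auto simp: TU)
    finally show ?thesis .
  qed
  have XU: "X * U 0 = - 1\<^sub>m m" "X * U 1 = 1\<^sub>m m" "X * U 2 = 0\<^sub>m m m"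
    unfolding X_def by (simp_all add: minus_mult_distrib_mat[of _ m n _ _ m] TU) (auto intro!: eq_matI)
  have XW: "X * W = 0\<^sub>m m m"
    unfolding X_def by (simp add: minus_mult_distrib_mat[of _ m n _ _ m] TW)
  have XG: "X * G = X"
  proof -
    have "X * G = X + X * (W * X)"
      unfolding G_def by (simp add: mult_add_distrib_mat[of _ m n _ n])
    also have "X * (W * X) = (X * W) * X" by (simp add: assoc_mult_mat[of _ m n _ m _ n])
    finally show ?thesis by (simp add: XW)
  qed

  \<comment> \<open>The base change and its inverse\<close>
  define R where "R = four_block_mat (1\<^sub>m n) W X (1\<^sub>m m)"
  define R' where "R' = four_block_mat G (- W) (- X) (1\<^sub>m m)"
  have R: "R \<in> carrier_mat r r" and R': "R' \<in> carrier_mat r r"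
    by (auto simp: R_def R'_def r)
  have "R * R' = four_block_mat (1\<^sub>m n * G + W * (- X)) (1\<^sub>m n * (- W) + W * 1\<^sub>m m)
      (X * G + 1\<^sub>m m * (- X)) (X * (- W) + 1\<^sub>m m * 1\<^sub>m m)"
    unfolding R_def R'_def by (rule mult_four_block_mat[of _ n n _ m _ m _ _ n _ m]) auto
  also have "\<dots> = four_block_mat (1\<^sub>m n) (0\<^sub>m n m) (0\<^sub>m m n) (1\<^sub>m m)"
  proof (rule cong_four_block_mat)
    show "1\<^sub>m n * G + W * (- X) = 1\<^sub>m n"
      unfolding left_mult_one_mat[OF G] by (auto intro!: eq_matI simp: G_def simp del: index_mult_mat(1))
  next
    show "1\<^sub>m n * (- W) + W * 1\<^sub>m m = 0\<^sub>m n m" by (simp add: uminus_l_inv_mat)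
    show "X * G + 1\<^sub>m m * (- X) = 0\<^sub>m m n" by (auto intro!: eq_matI simp: XG simp del: index_mult_mat(1))
    show "X * (- W) + 1\<^sub>m m * 1\<^sub>m m = 1\<^sub>m m"
      by (auto intro!: eq_matI simp: XW simp del: index_mult_mat(1))
  qed
  finally have RR': "R * R' = 1\<^sub>m r" by (simp add: r)
  \<comment> \<open>For square matrices a one-sided inverse is two-sided.\<close>
  then have R'R: "R' * R = 1\<^sub>m r" using mat_mult_left_right_inverse[OF R R'] by simp

  \<comment> \<open>The diagonal matrices and the corner blocks\<close>
  define E where "E a = U a * T a" for a
  have E [simp]: "E a \<in> carrier_mat n n" for a by (simp add: E_def)
  note [simp] = carrier_matD[OF E]
  \<comment> \<open>The last \<open>m\<close> diagonal entries are zero, so \<open>W\<close> and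
    \<open>X\<close> in the outer factors do not add to the corner, which stays
    \<open>G * E a\<close>.\<close>
  define D where "D a = four_block_mat (E a) (0\<^sub>m n m) (0\<^sub>m m n) (0\<^sub>m m m)" for a
  have D: "D a \<in> carrier_mat r r" for a by (simp add: D_def r)
  have "E a $$ (i, j) = 0" if "i < n" "j < n" "i \<noteq> j" for a i j
    using that by (simp add: E_def T_def U_def block_inclusion_mult_transpose del: index_mult_mat(1))
  then have D_diag: "diagonal_mat (D a)" for a
    using carrier_matD[OF E[of a]] unfolding diagonal_mat_def D_def by auto
  have block: "top_left_block n (R' * D a * R) = G * E a" for a
  proof -
    have "R' * D a = four_block_mat (G * E a + - W * 0\<^sub>m m n) (G * 0\<^sub>m n m + - W * 0\<^sub>m m m)
        (- X * E a + 1\<^sub>m m * 0\<^sub>m m n) (- X * 0\<^sub>m n m + 1\<^sub>m m * 0\<^sub>m m m)"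
      unfolding R'_def D_def by (rule mult_four_block_mat[of _ n n _ m _ m _ _ n _ m]) auto
    also have "\<dots> = four_block_mat (G * E a) (0\<^sub>m n m) (- X * E a) (0\<^sub>m m m)"
      by (rule cong_four_block_mat) auto
    finally have R'D: "R' * D a = four_block_mat (G * E a) (0\<^sub>m n m) (- X * E a) (0\<^sub>m m m)" .
    have R'DR: "R' * D a * R = four_block_mat (G * E a * 1\<^sub>m n + 0\<^sub>m n m * X) (G * E a * W + 0\<^sub>m n m * 1\<^sub>m m)
        (- X * E a * 1\<^sub>m n + 0\<^sub>m m m * X) (- X * E a * W + 0\<^sub>m m m * 1\<^sub>m m)"
      unfolding R'D R_def by (rule mult_four_block_mat[of _ n n _ m _ m _ _ n _ m]) auto
    have "top_left_block n (R' * D a * R) = G * E a * 1\<^sub>m n + 0\<^sub>m n m * X"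
      unfolding R'DR by (rule top_left_block_four_block_mat) simp
    also have "\<dots> = G * E a" by simp
    finally show ?thesis .
  qed

  \<comment> \<open>Products and commutators of the corner blocks\<close>
  define K where "K a = G * U a" for a
  have K [simp]: "K a \<in> carrier_mat n m" for a by (simp add: K_def)
  note [simp] = carrier_matD[OF K]
  \<comment> \<open>In \<open>T a * (1 + W * X) * E b\<close> the first term vanishes because
    \<open>a \<noteq> b\<close>, and \<open>T a * W = 1\<close> removes \<open>W\<close> from the
    second.\<close>
  have prod: "(G * E a) * (G * E b) = K a * ((X * U b) * T b)" if "a < 3" "a \<noteq> b" for a b
  proof -
    have "G * E b = E b + W * X * E b"
      unfolding G_def by (simp add: add_mult_distrib_mat[of _ n n _ _ n])
    also have "W * X * E b = W * ((X * U b) * T b)"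
      unfolding E_def by (simp add: assoc_mult_mat[of _ n m _ n _ n] assoc_mult_mat[of _ m n _ m _ n])
    finally have "T a * (G * E b) = T a * E b + T a * (W * ((X * U b) * T b))"
      by (simp add: mult_add_distrib_mat[of _ m n _ n])
    also have "T a * E b = (T a * U b) * T b"
      unfolding E_def by (simp add: assoc_mult_mat[of _ m n _ m _ n])
    also have "T a * (W * ((X * U b) * T b)) = (T a * W) * ((X * U b) * T b)"
      by (simp add: assoc_mult_mat[of _ m n _ m _ n])
    finally have "T a * (G * E b) = (X * U b) * T b"
      using that by (simp add: TU TW)
    moreover have "(G * E a) * (G * E b) = K a * (T a * (G * E b))"
      unfolding K_def E_def
      by (simp add: assoc_mult_mat[of _ n n _ n _ n] assoc_mult_mat[of _ n n _ m _ n] assoc_mult_mat[of _ n m _ n _ n])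
    ultimately show ?thesis by simp
  qed
  have C1: "commutator (G * E 0) (G * E 1) = K 0 * T 1 + K 1 * T 0"
    unfolding commutator_def prod[of 0 1, simplified] prod[of 1 0, simplified] XU
    by (auto intro!: eq_matI simp del: index_mult_mat(1))
  \<comment> \<open>The product ending in \<open>E 2\<close> is zero as \<open>X * U 2\<close> is;
    in the other one the sign of \<open>X * U 0\<close> cancels that of the commutator.\<close>
  have C2: "commutator (G * E 0) (G * E 2) = K 2 * T 0"
    unfolding commutator_def prod[of 0 2, simplified] prod[of 2 0, simplified] XU
    by (auto intro!: eq_matI simp del: index_mult_mat(1))

  \<comment> \<open>The sum of the two images\<close>
  define J where "J = mat n (3 * m) (\<lambda>(i, j). if i = j then 1 else 0 :: 'a)"
  \<comment> \<open>\<open>V\<close> and \<open>S\<close> play the part of \<open>U\<close> and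
    \<open>T\<close> with \<open>3 * m\<close> coordinates instead of \<open>n\<close>.\<close>
  define V :: "nat \<Rightarrow> 'a mat" where "V = block_inclusion (3 * m) m"
  define S where "S a = transpose_mat (V a)" for a
  have V [simp]: "V a \<in> carrier_mat (3 * m) m" and S [simp]: "S a \<in> carrier_mat m (3 * m)" for a
    by (simp_all add: V_def S_def)
  note [simp] = carrier_matD[OF V] carrier_matD[OF S]
  have J [simp]: "J \<in> carrier_mat n (3 * m)" by (simp add: J_def)
  note [simp] = carrier_matD[OF J]
  note J_facts = sum_of_block_inclusions[OF m3, where 'a = 'a, folded J_def U_def V_def, folded S_def]
  define H where "H = G * J"
  have H [simp]: "H \<in> carrier_mat n (3 * m)" by (simp add: H_def)
  note [simp] = carrier_matD[OF H]
  have KV: "K a = H * V a" if "a < 3" for a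
    unfolding K_def H_def J_facts(3)[OF that, symmetric]
    by (simp add: assoc_mult_mat[of _ n n _ "3 * m" _ m])
  have H_sum: "H = K 0 * S 0 + K 1 * S 1 + K 2 * S 2"
    unfolding H_def J_facts(1) K_def
    by (simp add: mult_add_distrib_mat[of _ n n _ "3 * m"] assoc_mult_mat[of _ n n _ m _ "3 * m"])
  \<comment> \<open>Blocks 0 and 1 are swapped to undo the crossing in
    \<open>K 0 * T 1 + K 1 * T 0\<close>: \<open>T 1 * Q = S 0\<close> and
    \<open>T 0 * Q = S 1\<close>.\<close>
  define Q where "Q = U 1 * S 0 + U 0 * S 1"
  have GG: "(1\<^sub>m n - W * X) * G = 1\<^sub>m n"
  proof -
    have "(1\<^sub>m n - W * X) * G = G - W * (X * G)"
      by (simp add: minus_mult_distrib_mat[of _ n n _ _ n] assoc_mult_mat[of _ n m _ n _ n])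
    also have "\<dots> = 1\<^sub>m n"
      unfolding XG by (auto intro!: eq_matI simp: G_def simp del: index_mult_mat(1))
    finally show ?thesis .
  qed
  have "vec_subspace_dim n (vec_subspace_sum n (Im_mat n (K 0 * T 1 + K 1 * T 0))
      (Im_mat n (K 2 * T 0))) = 3 * m"
  proof (rule dim_sum_of_images)
    show "K 0 * T 1 + K 1 * T 0 = H * (V 0 * T 1 + V 1 * T 0)"
      by (simp add: KV mult_add_distrib_mat[of _ n "3 * m" _ n] assoc_mult_mat[of _ n "3 * m" _ m _ n])
    show "K 2 * T 0 = H * (V 2 * T 0)"
      by (simp add: KV assoc_mult_mat[of _ n "3 * m" _ m _ n])
    have TQ: "T 1 * Q = S 0" "T 0 * Q = S 1"
      unfolding Q_def
      by (simp_all add: mult_add_distrib_mat[of _ m n _ "3 * m"]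
          assoc_mult_mat[of _ m n _ m _ "3 * m", symmetric] TU)
    have Q: "Q \<in> carrier_mat n (3 * m)" by (simp add: Q_def)
    note [simp] = carrier_matD[OF Q]
    have "(K 0 * T 1 + K 1 * T 0) * Q = K 0 * S 0 + K 1 * S 1"
      by (simp add: add_mult_distrib_mat[of _ n n _ _ "3 * m"]
          assoc_mult_mat[of _ n m _ n _ "3 * m"] TQ)
    \<comment> \<open>The second commutator reads its input from block 0, so the witness
      \<open>U 0 * S 2\<close> moves block 2 there.\<close>
    moreover have "T 0 * (U 0 * S 2) = S 2"
      by (simp add: assoc_mult_mat[of _ m n _ m _ "3 * m", symmetric] TU)
    then have "(K 2 * T 0) * (U 0 * S 2) = K 2 * S 2"
      by (simp add: assoc_mult_mat[of _ n m _ n _ "3 * m"])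
    ultimately show "H = (K 0 * T 1 + K 1 * T 0) * Q + K 2 * T 0 * (U 0 * S 2)"
      using H_sum by simp
    \<comment> \<open>The left inverse of \<open>H = G * J\<close> first undoes \<open>G\<close> by
      \<open>GG\<close>, then \<open>J\<close> by its transpose.\<close>
    have "transpose_mat J * (1\<^sub>m n - W * X) * H = transpose_mat J * ((1\<^sub>m n - W * X) * H)"
      by (rule assoc_mult_mat[of _ "3 * m" n _ n _ "3 * m"]) auto
    also have "(1\<^sub>m n - W * X) * H = ((1\<^sub>m n - W * X) * G) * J"
      unfolding H_def by (rule assoc_mult_mat[of _ n n _ n _ "3 * m", symmetric]) auto
    finally show "transpose_mat J * (1\<^sub>m n - W * X) * H = 1\<^sub>m (3 * m)"
      by (simp add: GG J_facts(2))
  qed (auto simp: Q_def)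
  then show ?thesis
    using R R' RR' R'R D D_diag
    by (intro exI[of _ R] exI[of _ R'] exI[of _ "D 0"] exI[of _ "D 1"] exI[of _ "D 2"])
      (simp add: block C1 C2 inverts_mat_def m_def Let_def del: carrier_matI)
qed

end
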